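(* Let $p_1,\dots,p_m$ be independent $p$-values with set of true nulls $\mathcal H_0\subset\{1,\dots,m\}$, such that $p_i\sim U(0,1)$ for $i\in\mathcal H_0$, let $\pi$ be a deterministic permutation of $\{1,\dots,m\}$ and let $s\in(0,1]$. For all $\delta\in(0,1)$ and $\lambda\in[0,1)$, setting $$R_k=\{\pi(i):1\le i\le k,\ p_{\pi(i)}\le s\},\qquad \overline{\mathrm{FDP}}_k^{\mathrm{Freed}}=1\wedge\frac{\frac{s}{1-\lambda}\sum_{i=1}^k\mathbf 1\{p_{\pi(i)}>\lambda\}+\Delta(\nu k)}{\sum_{i=1}^k\mathbf 1\{p_{\pi(i)}\le s\}},\qquad k=1,\dots,m,$$ where $\Delta(u)=2\sqrt{\varepsilon_u}\sqrt{u\vee1}+\frac12\varepsilon_u$, $\varepsilon_u=\log((1+\kappa)/\delta)+2\log(1+\log_2(u\vee1))$ for $u>0$, $\kappa=\pi_\circ^2/6$ (with $\pi_\circ=3.14159\ldots$), and $\nu=s\bigl(1+\min(s,\lambda)/(1-\lambda)\bigr)$, one has $$\mathbf P\bigl(\forall k\in\{1,\dots,m\},\ \mathrm{FDP}(R_k)\le\overline{\mathrm{FDP}}_k^{\mathrm{Freed}}\bigr)\ge1-\delta.$$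
   Context: Pre-ordered setting: $p_1,\dots,p_m\in[0,1]$ independent, $\mathcal H_0$ a fixed subset of $\{1,\dots,m\}$, nothing assumed on the marginals of $p_i$ for $i\notin\mathcal H_0$. $\mathrm{FDP}(R)=|R\cap\mathcal H_0|/(|R|\vee1)$. When the denominator of $\overline{\mathrm{FDP}}_k^{\mathrm{Freed}}$ is zero, the ratio is read as $+\infty$, so that $\overline{\mathrm{FDP}}_k^{\mathrm{Freed}}=1$. *)

theory Defs
  imports "HOL-Probability.Probability" "HOL-Combinatorics.Permutations"
begin

definition FDP :: "nat set \<Rightarrow> nat set \<Rightarrow> real" where
  "FDP H0 R = real (card (R \<inter> H0)) / real (max (card R) 1)"

definition kappa :: real where
  "kappa = pi\<^sup>2 / 6"

definition eps :: "real \<Rightarrow> real \<Rightarrow> real" where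
  "eps \<delta> u = ln ((1 + kappa) / \<delta>) + 2 * ln (1 + log 2 (max u 1))"

definition Delta :: "real \<Rightarrow> real \<Rightarrow> real" where
  "Delta \<delta> u = 2 * sqrt (eps \<delta> u) * sqrt (max u 1) + eps \<delta> u / 2"

definition nu :: "real \<Rightarrow> real \<Rightarrow> real" where
  "nu s lam = s * (1 + min s lam / (1 - lam))"

text \<open>In the following, \<open>x i\<close> is the (realized) value of the \<open>i\<close>-th p-value
  and \<open>\<sigma>\<close> is the ordering permutation.\<close>

definition rej_set :: "(nat \<Rightarrow> nat) \<Rightarrow> real \<Rightarrow> (nat \<Rightarrow> real) \<Rightarrow> nat \<Rightarrow> nat set" where
  "rej_set \<sigma> s x k = {\<sigma> i | i. 1 \<le> i \<and> i \<le> k \<and> x (\<sigma> i) \<le> s}"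

text \<open>A ratio with zero denominator is read as \<open>+\<infinity>\<close>, so that the minimum with 1 is 1;
  the case distinction is needed because real division by zero yields 0.\<close>

definition FDP_Freed ::
  "(nat \<Rightarrow> nat) \<Rightarrow> real \<Rightarrow> real \<Rightarrow> real \<Rightarrow> (nat \<Rightarrow> real) \<Rightarrow> nat \<Rightarrow> real" where
  "FDP_Freed \<sigma> s \<delta> lam x k =
    (let N = s / (1 - lam) * (\<Sum>i=1..k. of_bool (x (\<sigma> i) > lam)) + Delta \<delta> (nu s lam * real k);
         D = (\<Sum>i=1..k. of_bool (x (\<sigma> i) \<le> s))
     in if D = 0 then 1 else min 1 (N / D))"

end

theory Submission
  imports Defs
begin

text \<open>
  Over the true nulls, the increments \<open>1{p \<le> s} - s/(1-\<lambda>) 1{p > \<lambda>}\<close> are independent, centred,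
  bounded above by 1 and have second moment at most \<open>\<nu>\<close>; if their partial sums \<open>S\<^sub>k\<close> stay below
  \<open>\<Delta>(\<nu> k)\<close>, then the FDP bounds hold. For fixed \<open>t\<close>, the Bernstein-type bound
  \<open>exp y \<le> 1 + y + y\<^sup>2/(2-t)\<close> for \<open>y \<le> t < 2\<close> makes \<open>exp (t S\<^sub>k - k \<nu> t\<^sup>2/(2-t))\<close> a product
  of independent nonnegative factors of mean at most 1, to which the maximal inequality for
  nonnegative supermartingales applies (Markov's inequality for the product stopped on reaching the
  level). Optimising \<open>t\<close> separately on each dyadic range \<open>2\<^sup>j \<le> max (\<nu> k) 1 < 2\<^sup>j\<^sup>+\<^sup>1\<close> at level proportional
  to \<open>1/(1+j)\<^sup>2\<close> and summing over \<open>j\<close> yields the boundary \<open>\<Delta>\<close>.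
\<close>

section \<open>Elementary upper bounds for the exponential\<close>

text \<open>The logarithm of the quotient minus \<open>y\<close> vanishes at 0 and has derivative
  z^2 / (4 - z^2), which is nonnegative on the range.\<close>

lemma exp_le_pade:
  fixes y :: real
  assumes "0 \<le> y" "y < 2"
  shows "exp y \<le> (2 + y) / (2 - y)"
proof -
  define f where "f z = ln (2 + z) - ln (2 - z) - z" for z :: real
  have "f 0 \<le> f y"
  proof (rule DERIV_nonneg_imp_nondecreasing[OF assms(1)])
    fix z assume z: "0 \<le> z" "z \<le> y"
    have "(f has_real_derivative (1 / (2 + z) + 1 / (2 - z) - 1)) (at z)"
      unfolding f_def using z assms by (auto intro!: derivative_eq_intros)
    moreover have "1 / (2 + z) + 1 / (2 - z) - 1 = z\<^sup>2 / ((2 + z) * (2 - z))"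
      using z assms by (simp add: divide_simps) (simp add: algebra_simps power2_eq_square)
    moreover have "z\<^sup>2 / ((2 + z) * (2 - z)) \<ge> 0"
      using z assms by simp
    ultimately show "\<exists>d. (f has_real_derivative d) (at z) \<and> 0 \<le> d" by metis
  qed
  hence "y \<le> ln ((2 + y) / (2 - y))"
    using assms by (simp add: f_def ln_div)
  thus ?thesis using assms by (subst (asm) ln_ge_iff) auto
qed

lemma exp_le_quadratic_nonpos:
  fixes y :: real
  assumes "y \<le> 0"
  shows "exp y \<le> 1 + y + y\<^sup>2 / 2"
proof -
  define g where "g z = 1 + z + z\<^sup>2 / 2 - exp z" for z :: real
  have "g 0 \<le> g y"
  proof (rule DERIV_nonpos_imp_nonincreasing[OF assms])
    fix z :: real
    have "(g has_real_derivative (1 + z - exp z)) (at z)"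
      unfolding g_def by (auto intro!: derivative_eq_intros)
    moreover have "1 + z - exp z \<le> 0"
      using exp_ge_add_one_self[of z] by simp
    ultimately show "\<exists>d. (g has_real_derivative d) (at z) \<and> d \<le> 0" by blast
  qed
  thus ?thesis by (simp add: g_def)
qed

text \<open>The quotient (2 + y) / (2 - y) equals 1 + y + y^2 / (2 - y), and putting
  \<open>t\<close> for \<open>y\<close> lowers the last denominator; for negative \<open>y\<close>
  the denominator 2 already suffices. The bound is uniform and one-sided, so taking expectations
  involves only two moments of a variable bounded above.\<close>

lemma exp_le_quadratic:
  fixes t y :: real
  assumes "y \<le> t" "0 \<le> t" "t < 2"
  shows "exp y \<le> 1 + y + y\<^sup>2 / (2 - t)"
proof (cases "0 \<le> y")
  case True
  have "exp y \<le> (2 + y) / (2 - y)"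
    using True assms by (intro exp_le_pade) auto
  also have "\<dots> = 1 + y + y\<^sup>2 / (2 - y)"
    using True assms by (simp add: field_simps power2_eq_square)
  also have "\<dots> \<le> 1 + y + y\<^sup>2 / (2 - t)"
    using True assms by (intro add_left_mono divide_left_mono) auto
  finally show ?thesis .
next
  case False
  have "exp y \<le> 1 + y + y\<^sup>2 / 2"
    using False by (intro exp_le_quadratic_nonpos) auto
  also have "\<dots> \<le> 1 + y + y\<^sup>2 / (2 - t)"
    using assms by (intro add_left_mono divide_left_mono) auto
  finally show ?thesis .
qed

section \<open>Stopped products and the maximal inequality\<close>

text \<open>The partial product frozen once it reaches \<open>c\<close>. Testing the value at
  \<open>k\<close> before using factor \<open>Suc k\<close> makes the decision to stop depend on the
  first \<open>k\<close> factors alone; the recursion avoids naming a stopping time.\<close>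

fun stopped_prod :: "real \<Rightarrow> (nat \<Rightarrow> real) \<Rightarrow> nat \<Rightarrow> real" where
  "stopped_prod c y 0 = 1"
| "stopped_prod c y (Suc k) =
     (if stopped_prod c y k \<ge> c then stopped_prod c y k else stopped_prod c y k * y (Suc k))"

lemma stopped_prod_cong:
  "(\<And>i. i \<in> {1..k} \<Longrightarrow> y i = z i) \<Longrightarrow> stopped_prod c y k = stopped_prod c z k"
  by (induction k) auto

lemma stopped_prod_nonneg:
  "(\<And>i. i \<in> {1..k} \<Longrightarrow> 0 \<le> y i) \<Longrightarrow> 0 \<le> stopped_prod c y k"
  by (induction k) auto

text \<open>A value below \<open>c\<close> shows that no freezing has occurred, since a frozen value
  is at least \<open>c\<close> and never changes again.\<close>

lemma stopped_prod_eq_prod: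
  "\<not> stopped_prod c y k \<ge> c \<Longrightarrow> stopped_prod c y k = (\<Prod>i=1..k. y i)"
  by (induction k) (auto split: if_splits simp: mult.commute)

lemma stopped_prod_ge_mono:
  assumes "stopped_prod c y k \<ge> c" "k \<le> n"
  shows "stopped_prod c y n \<ge> c"
  using assms(2,1) by (induction rule: dec_induct) auto

text \<open>Either freezing has happened by \<open>k\<close>, or the stopped product still agrees
  with the plain one at \<open>k\<close>. This turns a crossing at some time up to \<open>n\<close>
  into an event at the single time \<open>n\<close>.\<close>

lemma stopped_prod_ge_if_prod_ge:
  assumes "(\<Prod>i=1..k. y i) \<ge> c" "k \<le> n"
  shows "stopped_prod c y n \<ge> c"
  using assms stopped_prod_eq_prod stopped_prod_ge_mono by metis

lemma measurable_stopped_prod: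
  assumes "{1..k} \<subseteq> I"
  shows "(\<lambda>y. stopped_prod c y k) \<in> borel_measurable (PiM I (\<lambda>_. borel))"
  using assms
proof (induction k)
  case (Suc k)
  have [measurable]: "(\<lambda>y. stopped_prod c y k) \<in> borel_measurable (PiM I (\<lambda>_. borel))"
    using Suc by (intro Suc.IH) auto
  have [measurable]: "(\<lambda>y. y (Suc k)) \<in> borel_measurable (PiM I (\<lambda>_. borel :: real measure))"
    using Suc.prems by (intro measurable_component_singleton) auto
  show ?case unfolding stopped_prod.simps by measurable
qed simp

context prob_space
begin

text \<open>Supermartingale step: only the part still running is multiplied by the new factor, and
  that part is nonnegative and independent of the factor, whose mean is at most 1.\<close>

lemma stopped_prod_integral:
  assumes ind: "indep_vars (\<lambda>_. borel) Y {1..n}"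
    and nn: "\<And>i \<omega>. i \<in> {1..n} \<Longrightarrow> 0 \<le> Y i \<omega>"
    and int: "\<And>i. i \<in> {1..n} \<Longrightarrow> integrable M (Y i)"
    and le1: "\<And>i. i \<in> {1..n} \<Longrightarrow> expectation (Y i) \<le> 1"
    and k: "k \<le> n"
  shows "integrable M (\<lambda>\<omega>. stopped_prod c (\<lambda>i. Y i \<omega>) k) \<and>
    expectation (\<lambda>\<omega>. stopped_prod c (\<lambda>i. Y i \<omega>) k) \<le> 1"
  using k
proof (induction k)
  case 0
  then show ?case by (simp add: prob_space)
next
  case (Suc k)
  define Z where "Z \<omega> = stopped_prod c (\<lambda>i. Y i \<omega>) k" for \<omega>
  define B where "B \<omega> = (if Z \<omega> \<ge> c then 0 else Z \<omega>)" for \<omega>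
  have IH: "integrable M Z" "expectation Z \<le> 1"
    using Suc unfolding Z_def by auto
  have [measurable]: "Z \<in> borel_measurable M" using IH by auto
  have [measurable]: "B \<in> borel_measurable M" unfolding B_def by measurable
  have Bint: "integrable M B"
    by (rule Bochner_Integration.integrable_bound[OF IH(1)]) (auto simp: B_def)
  have Bnn: "0 \<le> B \<omega>" for \<omega>
    unfolding B_def Z_def using nn Suc.prems by (auto intro!: stopped_prod_nonneg)
  have "indep_var borel B borel (Y (Suc k))"
  proof -
    \<comment> \<open>\<open>B\<close> is written as a function of the first \<open>k\<close>
      coordinates, so that independence of the disjoint blocks \<open>{1..k}\<close> and
      \<open>{Suc k}\<close> passes to it.\<close>
    define \<phi> where "\<phi> y = (if stopped_prod c y k \<ge> c then 0 else stopped_prod c y k)" for y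
    have "indep_var (PiM {1..k} (\<lambda>_. borel)) (\<lambda>\<omega>. restrict (\<lambda>i. Y i \<omega>) {1..k})
        (PiM {Suc k} (\<lambda>_. borel)) (\<lambda>\<omega>. restrict (\<lambda>i. Y i \<omega>) {Suc k})"
      using Suc.prems by (intro indep_var_restrict[OF ind]) auto
    moreover have "\<phi> \<in> borel_measurable (PiM {1..k} (\<lambda>_. borel))"
    proof -
      have [measurable]: "(\<lambda>y. stopped_prod c y k) \<in> borel_measurable (PiM {1..k} (\<lambda>_. borel))"
        by (rule measurable_stopped_prod) simp
      show ?thesis unfolding \<phi>_def by measurable
    qed
    moreover have "(\<lambda>y. y (Suc k)) \<in> borel_measurable (PiM {Suc k} (\<lambda>_. borel :: real measure))"
      by (intro measurable_component_singleton) auto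
    ultimately have "indep_var borel (\<phi> \<circ> (\<lambda>\<omega>. restrict (\<lambda>i. Y i \<omega>) {1..k}))
        borel ((\<lambda>y. y (Suc k)) \<circ> (\<lambda>\<omega>. restrict (\<lambda>i. Y i \<omega>) {Suc k}))"
      by (rule indep_var_compose)
    moreover have "\<phi> \<circ> (\<lambda>\<omega>. restrict (\<lambda>i. Y i \<omega>) {1..k}) = B"
    proof
      fix \<omega>
      have "stopped_prod c (restrict (\<lambda>i. Y i \<omega>) {1..k}) k = Z \<omega>"
        unfolding Z_def by (intro stopped_prod_cong) auto
      thus "(\<phi> \<circ> (\<lambda>\<omega>. restrict (\<lambda>i. Y i \<omega>) {1..k})) \<omega> = B \<omega>"
        by (simp add: \<phi>_def B_def)
    qed
    moreover have "(\<lambda>y. y (Suc k)) \<circ> (\<lambda>\<omega>. restrict (\<lambda>i. Y i \<omega>) {Suc k}) = Y (Suc k)"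
      by auto
    ultimately show ?thesis by simp
  qed
  note BY = indep_var_integrable[OF this Bint] indep_var_lebesgue_integral[OF this Bint]
  have Yint: "integrable M (Y (Suc k))" and Y1: "expectation (Y (Suc k)) \<le> 1"
    using int le1 Suc.prems by auto
  have eq: "stopped_prod c (\<lambda>i. Y i \<omega>) (Suc k) = (Z \<omega> - B \<omega>) + B \<omega> * Y (Suc k) \<omega>" for \<omega>
    by (simp add: Z_def B_def)
  have "expectation (\<lambda>\<omega>. (Z \<omega> - B \<omega>) + B \<omega> * Y (Suc k) \<omega>)
      = expectation Z - expectation B + expectation B * expectation (Y (Suc k))"
    using IH(1) Bint Yint BY by simp
  also have "\<dots> \<le> expectation Z"
    using mult_left_mono[OF Y1, of "expectation B"] Bnn by (simp add: integral_nonneg)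
  finally show ?case
    unfolding eq using IH Bint Yint BY by auto
qed

text \<open>Ville's inequality for partial products: a path that reaches \<open>c\<close> leaves the
  stopped product at least \<open>c\<close> at time \<open>n\<close>, where Markov's inequality
  applies.\<close>

lemma prod_maximal_inequality:
  fixes Y :: "nat \<Rightarrow> 'a \<Rightarrow> real"
  assumes ind: "indep_vars (\<lambda>_. borel) Y {1..n}"
    and nn: "\<And>i \<omega>. i \<in> {1..n} \<Longrightarrow> 0 \<le> Y i \<omega>"
    and int: "\<And>i. i \<in> {1..n} \<Longrightarrow> integrable M (Y i)"
    and le1: "\<And>i. i \<in> {1..n} \<Longrightarrow> expectation (Y i) \<le> 1"
    and c: "0 < c"
  shows "prob {\<omega> \<in> space M. \<exists>k\<in>{1..n}. (\<Prod>i=1..k. Y i \<omega>) \<ge> c} \<le> 1 / c"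
proof -
  let ?Z = "\<lambda>\<omega>. stopped_prod c (\<lambda>i. Y i \<omega>) n"
  have Z: "integrable M ?Z" "expectation ?Z \<le> 1"
    using stopped_prod_integral[OF ind nn int le1 order_refl] by auto
  have [measurable]: "?Z \<in> borel_measurable M" using Z by auto
  have "prob {\<omega> \<in> space M. \<exists>k\<in>{1..n}. (\<Prod>i=1..k. Y i \<omega>) \<ge> c} \<le> prob {\<omega> \<in> space M. ?Z \<omega> \<ge> c}"
    using stopped_prod_ge_if_prod_ge[of c] by (intro finite_measure_mono) auto
  also have "\<dots> \<le> expectation ?Z / c"
    using nn Z c by (intro integral_Markov_inequality_measure[where A="space M"])
      (auto intro!: stopped_prod_nonneg)
  also have "\<dots> \<le> 1 / c"
    using Z c by (intro divide_right_mono) auto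
  finally show ?thesis .
qed

section \<open>Bernstein-type maximal inequality\<close>

text \<open>The quadratic bound at t X loses its linear term in the mean because X is centred; the
  same quadratic dominates the exponential and gives integrability.\<close>

lemma exp_moment_le:
  fixes X :: "'a \<Rightarrow> real"
  assumes X: "integrable M X" "integrable M (\<lambda>\<omega>. (X \<omega>)\<^sup>2)"
    and mean: "expectation X = 0" and var: "expectation (\<lambda>\<omega>. (X \<omega>)\<^sup>2) \<le> v"
    and ub: "\<And>\<omega>. \<omega> \<in> space M \<Longrightarrow> X \<omega> \<le> 1"
    and t: "0 \<le> t" "t < 2"
  shows "integrable M (\<lambda>\<omega>. exp (t * X \<omega>))"
    and "expectation (\<lambda>\<omega>. exp (t * X \<omega>)) \<le> exp (v * (t\<^sup>2 / (2 - t)))"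
proof -
  have [measurable]: "X \<in> borel_measurable M" using X by auto
  let ?h = "t\<^sup>2 / (2 - t)"
  have le: "exp (t * X \<omega>) \<le> 1 + t * X \<omega> + ?h * (X \<omega>)\<^sup>2" if "\<omega> \<in> space M" for \<omega>
  proof -
    have "t * X \<omega> \<le> t" using mult_left_mono[OF ub[OF that] t(1)] by simp
    from exp_le_quadratic[OF this t] show ?thesis by (simp add: power_mult_distrib)
  qed
  have Q: "integrable M (\<lambda>\<omega>. 1 + t * X \<omega> + ?h * (X \<omega>)\<^sup>2)"
    using X by auto
  show int: "integrable M (\<lambda>\<omega>. exp (t * X \<omega>))"
  proof (rule Bochner_Integration.integrable_bound[OF Q])
    show "AE \<omega> in M. norm (exp (t * X \<omega>)) \<le> norm (1 + t * X \<omega> + ?h * (X \<omega>)\<^sup>2)"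
      using le by (intro AE_I2) fastforce
  qed auto
  have "expectation (\<lambda>\<omega>. exp (t * X \<omega>)) \<le> expectation (\<lambda>\<omega>. 1 + t * X \<omega> + ?h * (X \<omega>)\<^sup>2)"
    using int Q le by (intro integral_mono) auto
  also have "\<dots> = 1 + ?h * expectation (\<lambda>\<omega>. (X \<omega>)\<^sup>2)"
    using X mean by (simp add: prob_space)
  also have "\<dots> \<le> 1 + ?h * v"
    using var t by (intro add_left_mono mult_left_mono) auto
  also have "\<dots> \<le> exp (v * ?h)"
    using exp_ge_add_one_self[of "v * ?h"] by (simp add: mult.commute)
  finally show "expectation (\<lambda>\<omega>. exp (t * X \<omega>)) \<le> exp (v * ?h)" .
qed

text \<open>Chernoff's method with the compensated exponential exp(t S_k - k v h) of the partial
  sums S_k: its factors have mean at most 1, so it reaches exp x at some k with probability at most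
  exp(-x).\<close>

lemma bernstein_maximal_inequality:
  fixes X :: "nat \<Rightarrow> 'a \<Rightarrow> real"
  assumes ind: "indep_vars (\<lambda>_. borel) X {1..n}"
    and X: "\<And>i. i \<in> {1..n} \<Longrightarrow> integrable M (X i)"
      "\<And>i. i \<in> {1..n} \<Longrightarrow> integrable M (\<lambda>\<omega>. (X i \<omega>)\<^sup>2)"
    and mean: "\<And>i. i \<in> {1..n} \<Longrightarrow> expectation (X i) = 0"
    and var: "\<And>i. i \<in> {1..n} \<Longrightarrow> expectation (\<lambda>\<omega>. (X i \<omega>)\<^sup>2) \<le> v"
    and ub: "\<And>i \<omega>. i \<in> {1..n} \<Longrightarrow> \<omega> \<in> space M \<Longrightarrow> X i \<omega> \<le> 1"
    and V: "0 < V" and x: "0 < x"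
  shows "prob {\<omega> \<in> space M. \<exists>k\<in>{1..n}. v * real k \<le> V \<and>
            (\<Sum>i=1..k. X i \<omega>) \<ge> sqrt (2 * V * x) + x / 2} \<le> exp (- x)"
proof -
  \<comment> \<open>For given \<open>t\<close> the Chernoff level is (x + V h) / t. In the variable
    r = 2 t / (2 - t) it reads x/r + x/2 + V r/2, which is minimal at the \<open>r\<close> chosen
    here; solving for \<open>t\<close> gives \<open>r / (1 + r / 2)\<close>.\<close>
  define r where "r = sqrt (2 * x / V)"
  define t where "t = r / (1 + r / 2)"
  define h where "h = t\<^sup>2 / (2 - t)"
  define a where "a = sqrt (2 * V * x) + x / 2"
  have r: "0 < r" using V x by (simp add: r_def)
  have t: "0 < t" "t < 2" using r by (auto simp: t_def field_simps)
  have "2 - t = 2 / (1 + r / 2)" using r by (simp add: t_def field_simps)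
  hence "h = t * (t * (1 + r / 2)) / 2"
    using r by (simp add: h_def power2_eq_square)
  hence h: "h = r * t / 2"
    using r by (simp add: t_def)
  have r2: "r\<^sup>2 = 2 * x / V" using V x by (simp add: r_def)
  have "sqrt (2 * V * x) = V * r"
    using V x r by (intro real_sqrt_unique)
      (auto simp: power_mult_distrib r2, simp add: power2_eq_square)
  hence a: "a = V * r + x / 2" by (simp add: a_def)
  have xr: "x = V * r\<^sup>2 / 2" using V r2 by simp
  \<comment> \<open>this choice of \<open>t\<close> optimises the Chernoff exponent\<close>
  have opt: "t * a - V * h = x"
  proof -
    have "t * (1 + r / 2) = r" using r by (simp add: t_def)
    hence "t + t * r / 2 = r" by (simp add: algebra_simps)
    moreover have "t * a - V * h = V * r / 2 * (t + t * r / 2)"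
      unfolding a h xr by (simp add: algebra_simps power2_eq_square)
    ultimately show ?thesis unfolding xr by (simp add: power2_eq_square)
  qed
  have hnn: "0 \<le> h" using t by (simp add: h_def)
  define Y where "Y i \<omega> = exp (t * X i \<omega> - v * h)" for i \<omega>
  have Y: "integrable M (Y i)" "expectation (Y i) \<le> 1" if "i \<in> {1..n}" for i
  proof -
    note m = exp_moment_le[OF X(1)[OF that] X(2)[OF that] mean[OF that] var[OF that] ub[OF that],
        of t, folded h_def]
    show "integrable M (Y i)" unfolding Y_def exp_diff using m t by auto
    have "expectation (Y i) = expectation (\<lambda>\<omega>. exp (t * X i \<omega>)) / exp (v * h)"
      unfolding Y_def exp_diff by simp
    also have "\<dots> \<le> 1" using m t by (simp add: divide_le_eq)
    finally show "expectation (Y i) \<le> 1" .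
  qed
  have indY: "indep_vars (\<lambda>_. borel) Y {1..n}"
    unfolding Y_def by (rule indep_vars_compose2[OF ind]) auto
  have prodY: "(\<Prod>i=1..k. Y i \<omega>) = exp (t * (\<Sum>i=1..k. X i \<omega>) - real k * v * h)" for k \<omega>
    unfolding Y_def exp_sum[OF finite_atLeastAtMost, symmetric]
    by (simp add: sum_subtractf sum_distrib_left mult.assoc)
  have sub: "{\<omega> \<in> space M. \<exists>k\<in>{1..n}. v * real k \<le> V \<and> (\<Sum>i=1..k. X i \<omega>) \<ge> a}
      \<subseteq> {\<omega> \<in> space M. \<exists>k\<in>{1..n}. (\<Prod>i=1..k. Y i \<omega>) \<ge> exp x}"
  proof safe
    fix \<omega> k assume \<omega>: "\<omega> \<in> space M" and k: "k \<in> {1..n}" "v * real k \<le> V"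
      and S: "a \<le> (\<Sum>i=1..k. X i \<omega>)"
    \<comment> \<open>Since \<open>h\<close> is nonnegative, \<open>V\<close> may replace
      \<open>v * real k\<close> in the compensator, so a single \<open>t\<close> serves every
      \<open>k\<close> in the range.\<close>
    have "x \<le> t * (\<Sum>i=1..k. X i \<omega>) - real k * v * h"
    proof -
      have "t * a \<le> t * (\<Sum>i=1..k. X i \<omega>)" using S t by (intro mult_left_mono) auto
      moreover have "real k * v * h \<le> V * h"
        using mult_right_mono[OF k(2) hnn] by (simp add: mult.commute)
      ultimately show ?thesis using opt by linarith
    qed
    thus "\<exists>k\<in>{1..n}. (\<Prod>i=1..k. Y i \<omega>) \<ge> exp x"
      using k(1) unfolding prodY by auto
  qed
  have meas: "{\<omega> \<in> space M. \<exists>k\<in>{1..n}. (\<Prod>i=1..k. Y i \<omega>) \<ge> exp x} \<in> events"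
    using Y(1) by (intro sets.sets_Collect_finite_Ex borel_measurable_le borel_measurable_prod) auto
  have "prob {\<omega> \<in> space M. \<exists>k\<in>{1..n}. v * real k \<le> V \<and> (\<Sum>i=1..k. X i \<omega>) \<ge> a}
      \<le> prob {\<omega> \<in> space M. \<exists>k\<in>{1..n}. (\<Prod>i=1..k. Y i \<omega>) \<ge> exp x}"
    by (rule finite_measure_mono[OF sub meas])
  also have "\<dots> \<le> 1 / exp x"
    using Y by (intro prod_maximal_inequality[OF indY]) (auto simp: Y_def)
  finally show ?thesis by (simp add: a_def exp_minus inverse_eq_divide)
qed

section \<open>Stitching over dyadic ranges\<close>

text \<open>A union bound over variance scales: the cap \<open>2 ^ Suc j\<close> overstates the
  variance by at most a factor 2 within its range, and the level grows only like 2 ln(1 + j), hence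
  the iterated logarithm in \<open>eps\<close>.\<close>

lemma stitched_boundary:
  fixes X :: "nat \<Rightarrow> 'a \<Rightarrow> real"
  assumes ind: "indep_vars (\<lambda>_. borel) X {1..m}"
    and X: "\<And>i. i \<in> {1..m} \<Longrightarrow> integrable M (X i)"
      "\<And>i. i \<in> {1..m} \<Longrightarrow> integrable M (\<lambda>\<omega>. (X i \<omega>)\<^sup>2)"
    and mean: "\<And>i. i \<in> {1..m} \<Longrightarrow> expectation (X i) = 0"
    and var: "\<And>i. i \<in> {1..m} \<Longrightarrow> expectation (\<lambda>\<omega>. (X i \<omega>)\<^sup>2) \<le> v"
    and ub: "\<And>i \<omega>. i \<in> {1..m} \<Longrightarrow> \<omega> \<in> space M \<Longrightarrow> X i \<omega> \<le> 1"
    and \<delta>: "0 < \<delta>" "\<delta> < 1"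
  shows "prob {\<omega> \<in> space M. \<exists>k\<in>{1..m}. (\<Sum>i=1..k. X i \<omega>) \<ge> Delta \<delta> (v * real k)} \<le> \<delta>"
proof -
  \<comment> \<open>This is \<open>eps\<close> at u = 2^j, where log_2 u = j.\<close>
  define x where "x j = ln ((1 + kappa) / \<delta>) + 2 * ln (1 + real j)" for j :: nat
  define A where "A j = {\<omega> \<in> space M. \<exists>k\<in>{1..m}. v * real k \<le> 2 ^ Suc j \<and>
      (\<Sum>i=1..k. X i \<omega>) \<ge> sqrt (2 * 2 ^ Suc j * x j) + x j / 2}" for j
  have kappa: "0 < kappa" by (simp add: kappa_def)
  have "0 < ln ((1 + kappa) / \<delta>)" using kappa \<delta> by (intro ln_gt_zero) (simp add: field_simps)
  hence x: "0 < x j" for j by (simp add: x_def add_pos_nonneg)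
  have A: "A j \<in> events" for j
    unfolding A_def using X(1)
    by (intro sets.sets_Collect_finite_Ex sets.sets_Collect_conj borel_measurable_le borel_measurable_sum)
      auto
  have expx: "exp (- x j) = \<delta> / (1 + kappa) * (1 / (real j + 1)\<^sup>2)" for j
  proof -
    have "exp (x j) = exp (ln ((1 + kappa) / \<delta>)) * exp (ln (1 + real j)) ^ 2"
      unfolding x_def exp_add by (simp add: exp_double)
    also have "\<dots> = (1 + kappa) / \<delta> * (real j + 1)\<^sup>2"
      using kappa \<delta> by (simp add: exp_ln add.commute)
    finally show ?thesis by (simp add: exp_minus)
  qed
  have PA: "prob (A j) \<le> \<delta> / (1 + kappa) * (1 / (real j + 1)\<^sup>2)" for j
    unfolding A_def expx[symmetric]
    by (rule bernstein_maximal_inequality[OF ind X mean var ub]) (use x in auto)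
  \<comment> \<open>By the Basel series \<open>kappa\<close> is the total of the weights, so the
    failure probabilities add up to at most \<delta> kappa / (1 + kappa).\<close>
  have "(\<lambda>j. 1 / (real j + 1)\<^sup>2) sums kappa"
    using inverse_squares_sums unfolding kappa_def by (simp add: add.commute)
  from sums_mult[OF this, of "\<delta> / (1 + kappa)"]
  have sums: "(\<lambda>j. \<delta> / (1 + kappa) * (1 / (real j + 1)\<^sup>2)) sums (\<delta> / (1 + kappa) * kappa)" .
  have sA: "summable (\<lambda>j. prob (A j))"
    by (rule summable_comparison_test'[OF sums_summable[OF sums], of 0]) (use PA in auto)
  have "{\<omega> \<in> space M. \<exists>k\<in>{1..m}. (\<Sum>i=1..k. X i \<omega>) \<ge> Delta \<delta> (v * real k)} \<subseteq> (\<Union>j. A j)"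
  proof safe
    fix \<omega> k assume \<omega>: "\<omega> \<in> space M" and k: "k \<in> {1..m}"
      and S: "(\<Sum>i=1..k. X i \<omega>) \<ge> Delta \<delta> (v * real k)"
    \<comment> \<open>Truncation at 1 keeps the logarithm nonnegative, so that scale 0 also covers
      every \<open>k\<close> with v k < 1.\<close>
    define u where "u = max (v * real k) 1"
    define j where "j = nat \<lfloor>log 2 u\<rfloor>"
    have u: "1 \<le> u" by (simp add: u_def)
    have logu: "0 \<le> log 2 u" using u by simp
    have j: "real j \<le> log 2 u" "log 2 u < real j + 1"
      using logu unfolding j_def by linarith+
    have "2 powr real j \<le> u" using j(1) u by (simp add: le_log_iff)
    hence ju: "2 ^ j \<le> u" by (simp add: powr_realpow)
    have "u < 2 powr real (Suc j)" using j(2) u by (simp add: log_less_iff add.commute)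
    hence uj: "u < 2 ^ Suc j" by (subst (asm) powr_realpow) auto
    have e: "x j \<le> eps \<delta> (v * real k)"
      using j unfolding x_def eps_def u_def[symmetric] by simp
    \<comment> \<open>The factor 2 in \<open>Delta\<close> arises here: \<open>2 * 2 ^ Suc j\<close>
      is 4 times 2^j, and 2^j is at most \<open>u\<close>.\<close>
    have "sqrt (2 * 2 ^ Suc j * x j) = sqrt (2\<^sup>2 * (x j * 2 ^ j))"
      by (simp add: algebra_simps)
    also have "\<dots> = 2 * sqrt (x j) * sqrt (2 ^ j)"
      by (simp add: real_sqrt_mult)
    also have "\<dots> \<le> 2 * sqrt (eps \<delta> (v * real k)) * sqrt u"
      using e ju less_imp_le[OF x[of j]] by (intro mult_mono) auto
    finally have "sqrt (2 * 2 ^ Suc j * x j) + x j / 2 \<le> Delta \<delta> (v * real k)"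
      unfolding Delta_def u_def[symmetric] using e by simp
    moreover have "v * real k \<le> 2 ^ Suc j" using uj unfolding u_def by simp
    ultimately have "\<omega> \<in> A j" using S \<omega> k unfolding A_def by force
    thus "\<omega> \<in> (\<Union>j. A j)" by blast
  qed
  hence "prob {\<omega> \<in> space M. \<exists>k\<in>{1..m}. (\<Sum>i=1..k. X i \<omega>) \<ge> Delta \<delta> (v * real k)} \<le> prob (\<Union>j. A j)"
    using A by (intro finite_measure_mono) auto
  also have "\<dots> \<le> (\<Sum>j. prob (A j))"
    using A sA by (intro finite_measure_subadditive_countably) auto
  also have "\<dots> \<le> \<delta> / (1 + kappa) * kappa"
    using suminf_le[OF PA sA sums_summable[OF sums]] sums_unique[OF sums] by simp
  also have "\<dots> \<le> \<delta>"
    using kappa \<delta> by (simp add: field_simps)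
  finally show ?thesis .
qed

end

section \<open>Increments at the true nulls\<close>

text \<open>One step of the rejection count minus its estimate; the weight s / (1 - lam) centres it
  for uniform \<open>y\<close>. Both indicators are 1 when lam < y \<le> s.\<close>

definition null_incr :: "real \<Rightarrow> real \<Rightarrow> real \<Rightarrow> real" where
  "null_incr s lam y = of_bool (y \<le> s) - s / (1 - lam) * of_bool (y > lam)"

lemma measurable_null_incr [measurable]: "null_incr s lam \<in> borel_measurable borel"
  unfolding null_incr_def by measurable

lemma null_incr_le_1:
  assumes "0 < s" "lam < 1"
  shows "null_incr s lam y \<le> 1"
proof -
  have "0 \<le> s / (1 - lam)" using assms by simp
  thus ?thesis unfolding null_incr_def by (cases "y \<le> s"; cases "y > lam") auto
qed

lemma abs_null_incr_le:
  assumes "0 < s" "lam < 1"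
  shows "\<bar>null_incr s lam y\<bar> \<le> 1 + s / (1 - lam)"
proof -
  have "0 \<le> s / (1 - lam)" using assms by simp
  thus ?thesis unfolding null_incr_def by (cases "y \<le> s"; cases "y > lam") (auto simp del: abs_divide)
qed

context prob_space
begin

lemma uniform_prob:
  assumes d: "distr M lborel X = uniform_measure lborel {0..1::real}"
    and rv: "X \<in> borel_measurable M" and B: "B \<in> sets borel"
  shows "prob {\<omega> \<in> space M. X \<omega> \<in> B} = measure lborel ({0..1} \<inter> B)"
proof -
  have "prob {\<omega> \<in> space M. X \<omega> \<in> B} = measure (distr M lborel X) B"
    using rv B by (subst measure_distr) (auto simp: vimage_def Int_def conj_commute)
  also have "\<dots> = measure lborel ({0..1} \<inter> B)"
    unfolding d using B by (subst measure_uniform_measure) auto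
  finally show ?thesis .
qed

text \<open>With c = s / (1 - lam) the mean is s - c (1 - lam) = 0. In the square the cross term
  lives on (lam, s], which is empty unless lam < s; hence the minimum in \<open>nu\<close>.\<close>

lemma null_incr_moments:
  assumes d: "distr M lborel X = uniform_measure lborel {0..1::real}"
    and rv [measurable]: "X \<in> borel_measurable M"
    and s: "0 < s" "s \<le> 1" and lam: "0 \<le> lam" "lam < 1"
  shows "expectation (\<lambda>\<omega>. null_incr s lam (X \<omega>)) = 0"
    and "expectation (\<lambda>\<omega>. (null_incr s lam (X \<omega>))\<^sup>2) \<le> nu s lam"
proof -
  define c where "c = s / (1 - lam)"
  have E: "expectation (\<lambda>\<omega>. indicator B (X \<omega>)) = measure lborel ({0..1} \<inter> B)"
      "integrable M (\<lambda>\<omega>. indicator B (X \<omega>) :: real)"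
    if [measurable]: "B \<in> sets borel" for B
  proof -
    have *: "indicator B (X \<omega>) = (indicator (X -` B \<inter> space M) \<omega> :: real)" if "\<omega> \<in> space M" for \<omega>
      using that by (auto simp: indicator_def)
    have "expectation (\<lambda>\<omega>. indicator B (X \<omega>) :: real) = expectation (indicator (X -` B \<inter> space M))"
      by (rule Bochner_Integration.integral_cong[OF refl *])
    also have "\<dots> = prob {\<omega> \<in> space M. X \<omega> \<in> B}"
      by (simp add: vimage_def Int_def conj_commute)
    finally show "expectation (\<lambda>\<omega>. indicator B (X \<omega>)) = measure lborel ({0..1} \<inter> B)"
      using uniform_prob[OF d rv that] by simp
    show "integrable M (\<lambda>\<omega>. indicator B (X \<omega>) :: real)"
      by (rule integrable_const_bound[where B=1]) auto
  qed
  have "{0..1} \<inter> {..s} = {0..s}" "{0..1} \<inter> {lam<..} = {lam<..1}" "{0..1} \<inter> {lam<..s} = {lam<..s}"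
    using s lam by auto
  with E[of "{..s}"] E[of "{lam<..}"] E[of "{lam<..s}"] s lam
  have E': "expectation (\<lambda>\<omega>. indicator {..s} (X \<omega>)) = s"
      "expectation (\<lambda>\<omega>. indicator {lam<..} (X \<omega>)) = 1 - lam"
      "expectation (\<lambda>\<omega>. indicator {lam<..s} (X \<omega>)) = (if lam \<le> s then s - lam else 0)"
    and I: "integrable M (\<lambda>\<omega>. indicator {..s} (X \<omega>) :: real)"
      "integrable M (\<lambda>\<omega>. indicator {lam<..} (X \<omega>) :: real)"
      "integrable M (\<lambda>\<omega>. indicator {lam<..s} (X \<omega>) :: real)"
    by auto
  have eq: "null_incr s lam y = indicator {..s} y - c * indicator {lam<..} y" for y
    by (auto simp: null_incr_def c_def indicator_def)
  have sq: "(null_incr s lam y)\<^sup>2 = indicator {..s} y + c\<^sup>2 * indicator {lam<..} y - 2 * c * indicator {lam<..s} y" for y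
    by (auto simp: eq indicator_def power2_eq_square algebra_simps)
  have c1: "c * (1 - lam) = s" using lam by (simp add: c_def)
  have c0: "0 < c" using s lam by (simp add: c_def)
  show "expectation (\<lambda>\<omega>. null_incr s lam (X \<omega>)) = 0"
    unfolding eq using I E' c1 by simp
  have "expectation (\<lambda>\<omega>. (null_incr s lam (X \<omega>))\<^sup>2)
      = s + c\<^sup>2 * (1 - lam) - 2 * c * (if lam \<le> s then s - lam else 0)"
    unfolding sq using I E' by simp
  also have "c\<^sup>2 * (1 - lam) = c * s" using c1 by (simp add: power2_eq_square)
  \<comment> \<open>If lam \<le> s, the left side is s - c s + 2 c lam, and c lam \<le> c s;
    otherwise both sides are s + c s.\<close>
  also have "s + c * s - 2 * c * (if lam \<le> s then s - lam else 0) \<le> s + c * min s lam"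
  proof (cases "lam \<le> s")
    case True
    thus ?thesis using mult_left_mono[OF True less_imp_le[OF c0]] by (simp add: algebra_simps)
  qed (use c0 in auto)
  also have "s + c * min s lam = nu s lam"
    by (simp add: nu_def c_def algebra_simps)
  finally show "expectation (\<lambda>\<omega>. (null_incr s lam (X \<omega>))\<^sup>2) \<le> nu s lam" .
qed

end

section \<open>Pathwise comparison of the FDP with its bound\<close>

text \<open>Injectivity allows counting positions instead of hypotheses. \<open>H\<close> is left
  free: the set of nulls gives the numerator of the FDP, \<open>UNIV\<close> the number of
  rejections.\<close>

lemma card_rej_set_Int:
  assumes "inj_on \<sigma> {1..k}"
  shows "real (card (rej_set \<sigma> s x k \<inter> H)) = (\<Sum>i=1..k. of_bool (\<sigma> i \<in> H \<and> x (\<sigma> i) \<le> s))"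
proof -
  have "rej_set \<sigma> s x k \<inter> H = \<sigma> ` {i\<in>{1..k}. \<sigma> i \<in> H \<and> x (\<sigma> i) \<le> s}"
    by (auto simp: rej_set_def)
  moreover have "inj_on \<sigma> {i\<in>{1..k}. \<sigma> i \<in> H \<and> x (\<sigma> i) \<le> s}"
    using assms by (rule inj_on_subset) auto
  ultimately have "card (rej_set \<sigma> s x k \<inter> H) = card {i\<in>{1..k}. \<sigma> i \<in> H \<and> x (\<sigma> i) \<le> s}"
    by (simp add: card_image)
  thus ?thesis by (simp add: of_bool_def sum.If_cases Int_def)
qed

lemma FDP_rej_set:
  assumes "inj_on \<sigma> {1..k}"
  shows "FDP H0 (rej_set \<sigma> s x k) = (\<Sum>i=1..k. of_bool (\<sigma> i \<in> H0 \<and> x (\<sigma> i) \<le> s)) /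
    max (\<Sum>i=1..k. of_bool (x (\<sigma> i) \<le> s)) 1"
  using card_rej_set_Int[OF assms, of s x H0] card_rej_set_Int[OF assms, of s x UNIV]
  by (simp add: FDP_def of_nat_max)

text \<open>The number of rejected nulls is the sum of the null increments plus s / (1 - lam) times
  the number of nulls above \<open>lam\<close>; counting all p-values above \<open>lam\<close>
  instead can only enlarge this and gives the numerator of the bound.\<close>

lemma FDP_le_FDP_Freed:
  assumes inj: "inj_on \<sigma> {1..k}" and s: "0 < s" and lam: "lam < 1"
    and S: "(\<Sum>i=1..k. if \<sigma> i \<in> H0 then null_incr s lam (x (\<sigma> i)) else 0) \<le> Delta \<delta> (nu s lam * real k)"
  shows "FDP H0 (rej_set \<sigma> s x k) \<le> FDP_Freed \<sigma> s \<delta> lam x k"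
proof -
  define D :: real where "D = (\<Sum>i=1..k. of_bool (x (\<sigma> i) \<le> s))"
  define F :: real where "F = (\<Sum>i=1..k. of_bool (\<sigma> i \<in> H0 \<and> x (\<sigma> i) \<le> s))"
  define N where "N = s / (1 - lam) * (\<Sum>i=1..k. of_bool (x (\<sigma> i) > lam)) + Delta \<delta> (nu s lam * real k)"
  have FD: "FDP H0 (rej_set \<sigma> s x k) = F / max D 1"
    using FDP_rej_set[OF inj] by (simp add: F_def D_def)
  have FF: "FDP_Freed \<sigma> s \<delta> lam x k = (if D = 0 then 1 else min 1 (N / D))"
    by (simp add: FDP_Freed_def Let_def N_def D_def)
  have le: "F \<le> D" unfolding F_def D_def by (intro sum_mono) auto
  \<comment> \<open>\<open>D\<close> is a count: if it is 0 then so is \<open>F\<close>, and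
    otherwise \<open>max D 1\<close> is \<open>D\<close>.\<close>
  have D1: "D = 0 \<or> D \<ge> 1"
  proof -
    have "D = real (card (rej_set \<sigma> s x k))"
      using card_rej_set_Int[OF inj, of s x UNIV] unfolding D_def by simp
    thus ?thesis by (cases "card (rej_set \<sigma> s x k)") auto
  qed
  have "F \<le> (\<Sum>i=1..k. s / (1 - lam) * of_bool (x (\<sigma> i) > lam) +
      (if \<sigma> i \<in> H0 then null_incr s lam (x (\<sigma> i)) else 0))"
    unfolding F_def using s lam by (intro sum_mono) (auto simp: null_incr_def)
  also have "\<dots> \<le> N"
    unfolding N_def sum.distrib sum_distrib_left[symmetric] using S by simp
  finally have FN: "F \<le> N" .
  from D1 show ?thesis
  proof
    assume "D = 0"
    thus ?thesis unfolding FD FF using le by simp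
  next
    assume "D \<ge> 1"
    thus ?thesis unfolding FD FF using le FN by (auto simp: divide_right_mono divide_le_eq)
  qed
qed

section \<open>Ordered increments and the probability bound\<close>

theorem theorem18:
  fixes M :: "'a measure" and p :: "nat \<Rightarrow> 'a \<Rightarrow> real" and m :: nat
    and H0 :: "nat set" and \<sigma> :: "nat \<Rightarrow> nat" and s \<delta> lam :: real
  assumes "prob_space M"
    and "prob_space.indep_vars M (\<lambda>_. borel) p {1..m}"
    and "\<And>i \<omega>. i \<in> {1..m} \<Longrightarrow> \<omega> \<in> space M \<Longrightarrow> p i \<omega> \<in> {0..1}"
    and "H0 \<subseteq> {1..m}"
    and "\<And>i. i \<in> H0 \<Longrightarrow> distr M lborel (p i) = uniform_measure lborel {0..1}"
    and "\<sigma> permutes {1..m}"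
    and "s \<in> {0<..1}" and "\<delta> \<in> {0<..<1}" and "lam \<in> {0..<1}"
  shows "measure M {\<omega> \<in> space M. \<forall>k\<in>{1..m}.
           FDP H0 (rej_set \<sigma> s (\<lambda>i. p i \<omega>) k) \<le> FDP_Freed \<sigma> s \<delta> lam (\<lambda>i. p i \<omega>) k} \<ge> 1 - \<delta>"
proof -
  interpret prob_space M by fact
  note ind = assms(2) and nullunif = assms(5)
  have s: "0 < s" "s \<le> 1" and \<delta>: "0 < \<delta>" "\<delta> < 1" and lam: "0 \<le> lam" "lam < 1"
    using assms by auto
  have \<sigma>: "\<sigma> i \<in> {1..m}" if "i \<in> {1..m}" for i
    using permutes_in_image[OF assms(6)] that by blast
  have inj: "inj_on \<sigma> A" for A
    using permutes_inj[OF assms(6)] by (rule inj_on_subset) auto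
  have pm: "p i \<in> borel_measurable M" if "i \<in> {1..m}" for i
    using ind that by (auto simp: indep_vars_def)
  \<comment> \<open>Non-null positions contribute 0, so centring and the variance bound hold there
    whatever the marginal. The index is the rank, so partial sums follow the testing order.\<close>
  define \<phi> where "\<phi> i y = (if \<sigma> i \<in> H0 then null_incr s lam y else 0)" for i y
  define X where "X i \<omega> = \<phi> i (p (\<sigma> i) \<omega>)" for i \<omega>
  have \<phi>m: "\<phi> i \<in> borel_measurable borel" for i
    unfolding \<phi>_def by measurable
  have Xm: "X i \<in> borel_measurable M" if "i \<in> {1..m}" for i
    unfolding X_def using pm[OF \<sigma>[OF that]] \<phi>m by (rule measurable_compose)
  \<comment> \<open>Independence survives the reordering because the singleton blocks
    \<open>{\<sigma> j}\<close> are disjoint.\<close>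
  have "indep_vars (\<lambda>j. PiM {\<sigma> j} (\<lambda>_. borel)) (\<lambda>j \<omega>. restrict (\<lambda>i. p i \<omega>) {\<sigma> j}) {1..m}"
    using \<sigma> inj by (intro indep_vars_restrict[OF ind]) (auto simp: disjoint_family_on_def inj_on_def)
  hence "indep_vars (\<lambda>_. borel) (\<lambda>j \<omega>. \<phi> j ((restrict (\<lambda>i. p i \<omega>) {\<sigma> j}) (\<sigma> j))) {1..m}"
  proof (rule indep_vars_compose2[where Y="\<lambda>j f. \<phi> j (f (\<sigma> j))"])
    fix j
    have "(\<lambda>f. f (\<sigma> j)) \<in> borel_measurable (PiM {\<sigma> j} (\<lambda>_. borel :: real measure))"
      by (rule measurable_component_singleton) simp
    thus "(\<lambda>f. \<phi> j (f (\<sigma> j))) \<in> borel_measurable (PiM {\<sigma> j} (\<lambda>_. borel))"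
      by (rule measurable_compose[OF _ \<phi>m])
  qed
  hence indX: "indep_vars (\<lambda>_. borel) X {1..m}"
    by (simp add: X_def[abs_def])
  have Xb: "\<bar>X i \<omega>\<bar> \<le> 1 + s / (1 - lam)" for i \<omega>
    unfolding X_def \<phi>_def using s lam abs_null_incr_le[of s lam] by auto
  have X1: "integrable M (X i)" if "i \<in> {1..m}" for i
    using Xb Xm[OF that] by (intro integrable_const_bound[where B="1 + s / (1 - lam)"]) auto
  have X2: "integrable M (\<lambda>\<omega>. (X i \<omega>)\<^sup>2)" if "i \<in> {1..m}" for i
    using Xm[OF that] power_mono[OF Xb abs_ge_zero, of _ _ 2]
    by (intro integrable_const_bound[where B="(1 + s / (1 - lam))\<^sup>2"]) auto
  \<comment> \<open>This is the variance bound at the non-null positions.\<close>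
  have nu: "0 \<le> nu s lam" using s lam by (simp add: nu_def)
  have mom: "expectation (X i) = 0" "expectation (\<lambda>\<omega>. (X i \<omega>)\<^sup>2) \<le> nu s lam" if "i \<in> {1..m}" for i
    using null_incr_moments[OF nullunif pm[OF \<sigma>[OF that]] s lam] nu
    by (cases "\<sigma> i \<in> H0"; simp add: X_def[abs_def] \<phi>_def)+
  let ?bad = "{\<omega> \<in> space M. \<exists>k\<in>{1..m}. (\<Sum>i=1..k. X i \<omega>) \<ge> Delta \<delta> (nu s lam * real k)}"
  let ?good = "{\<omega> \<in> space M. \<forall>k\<in>{1..m}.
      FDP H0 (rej_set \<sigma> s (\<lambda>i. p i \<omega>) k) \<le> FDP_Freed \<sigma> s \<delta> lam (\<lambda>i. p i \<omega>) k}"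
  have "X i \<omega> \<le> 1" for i \<omega>
    unfolding X_def \<phi>_def using null_incr_le_1 s lam by auto
  hence bad: "prob ?bad \<le> \<delta>"
    using indX X1 X2 mom \<delta> by (intro stitched_boundary) auto
  have badm: "?bad \<in> events"
    using Xm by (intro sets.sets_Collect_finite_Ex borel_measurable_le borel_measurable_sum) auto
  \<comment> \<open>Monotonicity of the measure needs this event to be measurable; sums of
    indicators replace the set-valued rejections by real random variables.\<close>
  have goodm: "?good \<in> events"
  proof (rule sets.sets_Collect_finite_All)
    fix k assume k: "k \<in> {1..m}"
    have sum_meas: "(\<lambda>\<omega>. \<Sum>i=1..k. of_bool (P i (p (\<sigma> i) \<omega>)) :: real) \<in> borel_measurable M"
      if [measurable]: "\<And>i. Measurable.pred borel (P i)" for P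
    proof (rule borel_measurable_sum)
      fix i assume "i \<in> {1..k}"
      hence [measurable]: "p (\<sigma> i) \<in> borel_measurable M" using k by (intro pm \<sigma>) auto
      show "(\<lambda>\<omega>. of_bool (P i (p (\<sigma> i) \<omega>)) :: real) \<in> borel_measurable M" by measurable
    qed
    define F :: "'a \<Rightarrow> real" where "F \<omega> = (\<Sum>i=1..k. of_bool (\<sigma> i \<in> H0 \<and> p (\<sigma> i) \<omega> \<le> s))" for \<omega>
    define D :: "'a \<Rightarrow> real" where "D \<omega> = (\<Sum>i=1..k. of_bool (p (\<sigma> i) \<omega> \<le> s))" for \<omega>
    define N :: "'a \<Rightarrow> real" where "N \<omega> = (\<Sum>i=1..k. of_bool (p (\<sigma> i) \<omega> > lam))" for \<omega>
    have [measurable]: "F \<in> borel_measurable M"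
      unfolding F_def by (rule sum_meas[of "\<lambda>i y. \<sigma> i \<in> H0 \<and> y \<le> s"]) measurable
    have [measurable]: "D \<in> borel_measurable M"
      unfolding D_def by (rule sum_meas[of "\<lambda>_ y. y \<le> s"]) measurable
    have [measurable]: "N \<in> borel_measurable M"
      unfolding N_def by (rule sum_meas[of "\<lambda>_ y. y > lam"]) measurable
    show "{\<omega> \<in> space M. FDP H0 (rej_set \<sigma> s (\<lambda>i. p i \<omega>) k) \<le> FDP_Freed \<sigma> s \<delta> lam (\<lambda>i. p i \<omega>) k}
        \<in> events"
      unfolding FDP_rej_set[OF inj] FDP_Freed_def Let_def F_def[symmetric] D_def[symmetric] N_def[symmetric]
      by (rule borel_measurable_le) measurable
  qed simp
  have "space M - ?bad \<subseteq> ?good"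
    using FDP_le_FDP_Freed[OF inj s(1) lam(2)] by (force simp: X_def \<phi>_def)
  hence "prob (space M - ?bad) \<le> prob ?good"
    using goodm by (rule finite_measure_mono)
  thus ?thesis using prob_compl[OF badm] bad by simp
qed

end
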